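(* Let $k$ be a positive integer. If $\Lambda,\Delta$ are families of partitions and $\mathbf{C}_\Gamma$ appears with nonzero coefficient in the expansion of the product $\mathbf{C}_\Lambda\mathbf{C}_\Delta$ in the basis $(\mathbf{C}_\Gamma)_\Gamma$ of $\mathcal{I}_\infty^k$, then $$\max(|\Lambda|,|\Delta|)\le|\Gamma|\le|\Lambda|+|\Delta|.$$ In other words, the function $\deg:\mathcal{I}_\infty^k\to\mathbb{N}$ defined on the basis elements by $\deg(\mathbf{C}_\Lambda)=|\Lambda|$ is a filtration on $\mathcal{I}_\infty^k$.
   Context: Fix a positive integer $k$. For $i\ge1$ let $p_k(i)=\{(i-1)k+1,\dots,ik\}$; such a set is called a $k$-tuple. For a finite disjoint union $d$ of $k$-tuples, $\mathcal{B}_d^k$ is the group of permutations of $d$ that permute the $k$-tuples contained in $d$. A family of partitions is $\Lambda=(\Lambda(\lambda))_{\lambda\vdash k}$, where each $\Lambda(\lambda)$ is a (possibly empty) partition; $|\Lambda|=\sum_{\lambda\vdash k}|\Lambda(\lambda)|$. Type: for $\omega\in\mathcal{B}_d^k$, consider each cycle, of length $m$ say, of the permutation induced by $\omega$ on the $k$-tuples of $d$. The union of the $k$-tuples in this cycle is a union of cycles of $\omega$; choose one of these $k$-tuples $p_k(i)$ and let $\rho\vdash k$ be the partition formed by the numbers of elements of $p_k(i)$ lying in each of these cycles of $\omega$ (independent of $i$). This contributes one part $m$ to a partition denoted $\omega(\rho)$. The type of $\omega$ is the family $(\omega(\rho))_{\rho\vdash k}$. A $k$-partial permutation is a pair $(d,\omega)$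 with $d$ a finite disjoint union of $k$-tuples and $\omega\in\mathcal{B}_d^k$; its type is the type of $\omega$. The product is $(d_1,\omega_1)(d_2,\omega_2)=(d_1\cup d_2,\omega_1\omega_2)$, with $\omega_1,\omega_2$ extended by the identity to $d_1\cup d_2$. $\mathcal{I}_\infty^k$ is the algebra of finite complex linear combinations of the formal (infinite) sums $\mathbf{C}_\Lambda=\sum(d,\omega)$ over all $k$-partial permutations $(d,\omega)$ of type $\Lambda$ (so $d$ consists of $|\Lambda|$ $k$-tuples), for all families $\Lambda$; the $\mathbf{C}_\Lambda$ form a basis. A degree function given on the basis is extended to a nonzero element as the maximum of the degrees of the basis elements occurring in it with nonzero coefficient (the zero element having degree $-\infty$ by convention). It is a filtration if the degree of a product $xy$ is at most the sum of the degrees of $x$ and $y$. *)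

theory Defs
  imports
    Complex_Main
    "HOL-Library.Multiset"
    "HOL-Library.Extended_Real"
    "HOL-Library.Function_Algebras"
    "HOL-Combinatorics.Permutations"
    "HOL-Combinatorics.Orbits"
begin

section \<open>Families of partitions\<close>

text \<open>A partition is the multiset of its (positive) parts.\<close>

definition is_partition :: "nat multiset \<Rightarrow> bool" where
  "is_partition \<mu> \<longleftrightarrow> 0 \<notin># \<mu>"

definition partition_of :: "nat multiset \<Rightarrow> nat \<Rightarrow> bool" where
  "partition_of \<mu> n \<longleftrightarrow> is_partition \<mu> \<and> sum_mset \<mu> = n"

type_synonym family = "nat multiset \<Rightarrow> nat multiset"

text \<open>Families are indexed by the partitions of \<open>k\<close>; as total functions they are
  normalised to be empty at every other argument, so that equality of families is
  equality of functions.\<close>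

definition families :: "nat \<Rightarrow> family set" where
  "families k = {\<Lambda>. (\<forall>\<rho>. partition_of \<rho> k \<longrightarrow> is_partition (\<Lambda> \<rho>)) \<and>
                     (\<forall>\<rho>. \<not> partition_of \<rho> k \<longrightarrow> \<Lambda> \<rho> = {#})}"

definition family_size :: "nat \<Rightarrow> family \<Rightarrow> nat" where
  "family_size k \<Lambda> = (\<Sum>\<rho>\<in>{\<rho>. partition_of \<rho> k}. sum_mset (\<Lambda> \<rho>))"


section \<open>Partial permutations and their types\<close>

definition ktuple :: "nat \<Rightarrow> nat \<Rightarrow> nat set" where
  "ktuple k i = {(i - 1) * k + 1 .. i * k}"

definition ktuples_in :: "nat \<Rightarrow> nat set \<Rightarrow> nat set set" where
  "ktuples_in k d = {ktuple k i | i. 1 \<le> i \<and> ktuple k i \<subseteq> d}"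

definition ktuple_unions :: "nat \<Rightarrow> nat set set" where
  "ktuple_unions k = {\<Union>i\<in>I. ktuple k i | I. finite I \<and> (\<forall>i\<in>I. 1 \<le> i)}"

text \<open>Elements of the group are functions on all of \<open>nat\<close> fixing every point outside
  \<open>d\<close>; extending them by the identity to a larger set therefore leaves them unchanged.\<close>

definition tuple_perms :: "nat \<Rightarrow> nat set \<Rightarrow> (nat \<Rightarrow> nat) set" where
  "tuple_perms k d = {\<omega>. \<omega> permutes d \<and> (\<forall>p\<in>ktuples_in k d. \<omega> ` p \<in> ktuples_in k d)}"

type_synonym partial_perm = "nat set \<times> (nat \<Rightarrow> nat)"

definition partial_perms :: "nat \<Rightarrow> partial_perm set" where
  "partial_perms k = {(d, \<omega>). d \<in> ktuple_unions k \<and> \<omega> \<in> tuple_perms k d}"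

definition pp_mult :: "partial_perm \<Rightarrow> partial_perm \<Rightarrow> partial_perm" where
  "pp_mult a b = (fst a \<union> fst b, snd a \<circ> snd b)"

text \<open>The cycles (fixed points included) of the permutation \<open>p \<mapsto> \<omega> ` p\<close> of the
  \<open>k\<close>-tuples of \<open>d\<close>.\<close>

definition tuple_cycles :: "nat \<Rightarrow> partial_perm \<Rightarrow> nat set set set" where
  "tuple_cycles k a = orbit (image (snd a)) ` ktuples_in k (fst a)"

text \<open>For a cycle \<open>c\<close> of tuples, the sets \<open>orbit \<omega> x\<close> with \<open>x \<in> \<Union>c\<close> are the cycles of
  \<open>\<omega>\<close> whose union is \<open>\<Union>c\<close>.\<close>

definition cycle_partition :: "(nat \<Rightarrow> nat) \<Rightarrow> nat set set \<Rightarrow> nat multiset" where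
  "cycle_partition \<omega> c =
     (let p = (SOME p. p \<in> c)
      in image_mset (\<lambda>z. card (p \<inter> z)) (mset_set (orbit \<omega> ` \<Union>c)))"

definition pp_type :: "nat \<Rightarrow> partial_perm \<Rightarrow> family" where
  "pp_type k a = (\<lambda>\<rho>. image_mset card
     (mset_set {c \<in> tuple_cycles k a. cycle_partition (snd a) c = \<rho>}))"


section \<open>Formal sums\<close>

text \<open>A possibly infinite formal sum of partial permutations is its coefficient function.\<close>

type_synonym formal_sum = "partial_perm \<Rightarrow> complex"

definition fs_scale :: "complex \<Rightarrow> formal_sum \<Rightarrow> formal_sum" where
  "fs_scale c x = (\<lambda>a. c * x a)"

global_interpretation fs: vector_space fs_scale
  by unfold_locales (auto simp: fs_scale_def plus_fun_def algebra_simps)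

text \<open>Only finitely many pairs multiply to a given \<open>(d, \<omega>)\<close>, because the supports of both
  factors are contained in the finite set \<open>d\<close>.\<close>

definition fs_mult :: "nat \<Rightarrow> formal_sum \<Rightarrow> formal_sum \<Rightarrow> formal_sum" where
  "fs_mult k x y = (\<lambda>c. \<Sum>(a, b)\<in>{(a, b). a \<in> partial_perms k \<and> b \<in> partial_perms k
                                           \<and> pp_mult a b = c}. x a * y b)"

definition class_sum :: "nat \<Rightarrow> family \<Rightarrow> formal_sum" where
  "class_sum k \<Lambda> = (\<lambda>a. if a \<in> partial_perms k \<and> pp_type k a = \<Lambda> then 1 else 0)"

definition class_basis :: "nat \<Rightarrow> formal_sum set" where
  "class_basis k = class_sum k ` families k"

definition I_infty :: "nat \<Rightarrow> formal_sum set" where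
  "I_infty k = fs.span (class_basis k)"

definition class_coeff :: "nat \<Rightarrow> formal_sum \<Rightarrow> family \<Rightarrow> complex" where
  "class_coeff k x \<Gamma> = fs.representation (class_basis k) x (class_sum k \<Gamma>)"


section \<open>Degree functions\<close>

text \<open>The index set is finite for \<open>x \<in> I_infty k\<close>, so the supremum is a maximum if \<open>x \<noteq> 0\<close>;
  for \<open>x = 0\<close> it is empty and the supremum is \<open>-\<infinity>\<close>.\<close>

definition extend_degree :: "nat \<Rightarrow> (family \<Rightarrow> nat) \<Rightarrow> formal_sum \<Rightarrow> ereal" where
  "extend_degree k \<delta> x = (SUP \<Gamma>\<in>{\<Gamma> \<in> families k. class_coeff k x \<Gamma> \<noteq> 0}. ereal (real (\<delta> \<Gamma>)))"

definition is_filtration :: "nat \<Rightarrow> (formal_sum \<Rightarrow> ereal) \<Rightarrow> bool" where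
  "is_filtration k D \<longleftrightarrow>
     (\<forall>x\<in>I_infty k. \<forall>y\<in>I_infty k. D (fs_mult k x y) \<le> D x + D y)"

end

(* A partial permutation (d, \<omega>) of type \<Gamma> is supported on exactly |\<Gamma>| many k-tuples: the cycles
   of \<omega> on the k-tuples of d partition these k-tuples, and each of the cycles is recorded in
   \<Gamma>(\<rho>) for one partition \<rho> of k.  If C_\<Gamma> occurs in the expansion of x y, pick c of type \<Gamma>;
   the coefficient of c in x y is nonzero, so c = a b where a, b occur in x, y.  The support of c
   is the union of those of a and b, which gives both inequalities.

   It is not necessary to prove that the class sums are independent or that they span an
   algebra: where this fails, the coefficients given by fs.representation are all 0. *)

theory Submission
  imports Defs "HOL-Combinatorics.Cycles"
begin

section \<open>Orbits of periodic maps\<close>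

text \<open>\<open>orbit f s\<close> starts at \<open>f s\<close>, so \<open>s\<close> lies in it
  only when \<open>s\<close> is periodic. The first assumption makes orbits the classes of an
  equivalence relation.\<close>

lemma orbit_eq:
  assumes "\<And>s. s \<in> orbit f s" "y \<in> orbit f x"
  shows "orbit f y = orbit f x"
  using assms by (meson orbit_swap orbit_trans subsetI subset_antisym)

lemma disjoint_orbits:
  assumes "\<And>s. s \<in> orbit f s"
  shows "disjoint_family_on id (orbit f ` A)"
  unfolding disjoint_family_on_def id_def
proof (intro ballI impI, rule ccontr)
  fix X Y assume "X \<in> orbit f ` A" "Y \<in> orbit f ` A" "X \<noteq> Y" "X \<inter> Y \<noteq> {}"
  then obtain x y z where "X = orbit f x" "Y = orbit f y" "z \<in> X" "z \<in> Y"
    by blast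
  then have "X = orbit f z" "Y = orbit f z"
    using orbit_eq[of f, OF assms] by metis+
  with \<open>X \<noteq> Y\<close> show False
    by simp
qed

lemma funpow_image:
  fixes f :: "'a \<Rightarrow> 'a"
  shows "(image f ^^ n) A = (f ^^ n) ` A"
  by (induction n) (auto simp: image_comp)

text \<open>\<open>image f\<close> may move infinitely many sets even though \<open>f\<close> has
  finite support. Its periodicity comes from a positive power of \<open>f\<close> being the
  identity, which passes to images.\<close>

lemma self_in_orbit_image:
  assumes "permutation f"
  shows "A \<in> orbit (image f) A"
proof -
  obtain n where "f ^^ n = id" "n > 0"
    using permutation_is_nilpotent[OF assms] .
  then have "A = (image f ^^ n) A"
    by (simp add: funpow_image)
  with \<open>n > 0\<close> show ?thesis
    unfolding orbit_altdef by blast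
qed

lemma orbit_in_invariant:
  assumes "x \<in> A" "\<And>y. y \<in> A \<Longrightarrow> f y \<in> A"
  shows "orbit f x \<subseteq> A"
proof
  fix y assume "y \<in> orbit f x"
  then show "y \<in> A" by induction (use assms in auto)
qed


section \<open>Unions of tuples\<close>

text \<open>The last element \<open>i * k\<close> identifies the tuple:
  \<open>(j - 1) * k < i * k \<le> j * k\<close> forces \<open>j = i\<close>. A union of tuples
  therefore determines its index set.\<close>

lemma ktuple_subset_UN_iff:
  assumes "1 \<le> k" "1 \<le> i" "\<forall>j\<in>I. 1 \<le> j"
  shows "ktuple k i \<subseteq> (\<Union>j\<in>I. ktuple k j) \<longleftrightarrow> i \<in> I"
proof
  assume sub: "ktuple k i \<subseteq> (\<Union>j\<in>I. ktuple k j)"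
  have "i * k = (i - 1) * k + k"
    using assms(2) by (cases i) auto
  then have "i * k \<in> ktuple k i"
    using assms(1) by (simp add: ktuple_def)
  then obtain j where j: "j \<in> I" "i * k \<in> ktuple k j"
    using sub by auto
  then have "(j - 1) * k + 1 \<le> i * k" "i * k \<le> j * k"
    by (simp_all only: ktuple_def atLeastAtMost_iff)
  then have "(j - 1) * k < i * k" "i * k \<le> j * k"
    by linarith+
  then have "j - 1 < i" "i \<le> j"
    using assms(1) by (simp_all only: mult_less_cancel2 mult_le_cancel2)
  with j assms(3) show "i \<in> I"
    by (metis One_nat_def Suc_pred le_antisym less_eq_Suc_le)
qed blast

lemma ktuples_in_UN:
  assumes "1 \<le> k" "\<forall>j\<in>I. 1 \<le> j"
  shows "ktuples_in k (\<Union>i\<in>I. ktuple k i) = ktuple k ` I"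
  using assms(2) ktuple_subset_UN_iff[OF assms(1) _ assms(2)] unfolding ktuples_in_def by blast

lemma finite_ktuples_in:
  assumes "1 \<le> k" "d \<in> ktuple_unions k"
  shows "finite (ktuples_in k d)"
  using assms by (auto simp: ktuple_unions_def ktuples_in_UN)

text \<open>This relies on both sets consisting of whole tuples; for arbitrary sets a tuple of the
  union could be split between them.\<close>

lemma ktuples_in_Un:
  assumes "1 \<le> k" "d \<in> ktuple_unions k" "e \<in> ktuple_unions k"
  shows "ktuples_in k (d \<union> e) = ktuples_in k d \<union> ktuples_in k e"
proof -
  from assms(2,3) obtain I J where
    "d = (\<Union>i\<in>I. ktuple k i)" "\<forall>i\<in>I. 1 \<le> i" "e = (\<Union>i\<in>J. ktuple k i)" "\<forall>i\<in>J. 1 \<le> i"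
    by (auto simp: ktuple_unions_def)
  moreover have "d \<union> e = (\<Union>i\<in>I \<union> J. ktuple k i)"
    using calculation by auto
  ultimately show ?thesis
    using ktuples_in_UN[OF assms(1), of "I \<union> J"] ktuples_in_UN[OF assms(1), of I]
      ktuples_in_UN[OF assms(1), of J] by (auto simp: image_Un)
qed

lemma finite_ktuple_union: "d \<in> ktuple_unions k \<Longrightarrow> finite d"
  by (auto simp: ktuple_unions_def ktuple_def)

lemma card_ktuple:
  assumes "1 \<le> i"
  shows "card (ktuple k i) = k"
  using assms by (cases i) (auto simp: ktuple_def)


section \<open>The size of the type of a partial permutation\<close>

text \<open>Positive parts with sum \<open>k\<close> are at most \<open>k\<close> in number and in
  size. Finiteness matters because a sum over an infinite set is 0 by convention.\<close>

lemma finite_partitions: "finite {\<rho>. partition_of \<rho> k}"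
proof (rule finite_subset)
  show "{\<rho>. partition_of \<rho> k} \<subseteq> mset ` {xs. set xs \<subseteq> {..k} \<and> length xs \<le> k}"
  proof
    fix \<rho> :: "nat multiset" assume "\<rho> \<in> {\<rho>. partition_of \<rho> k}"
    then have \<rho>: "0 \<notin># \<rho>" "sum_mset \<rho> = k"
      by (auto simp: partition_of_def is_partition_def)
    obtain xs where xs: "mset xs = \<rho>"
      using ex_mset by blast
    have "0 \<notin> set xs" "sum_list xs = k"
      using \<rho> xs by (auto simp flip: sum_mset_sum_list)
    moreover have "length ys \<le> sum_list ys" if "0 \<notin> set ys" for ys :: "nat list"
      using that by (induction ys) auto
    ultimately have "set xs \<subseteq> {..k}" "length xs \<le> k"
      by (auto dest: member_le_sum_list)
    with xs show "\<rho> \<in> mset ` {xs. set xs \<subseteq> {..k} \<and> length xs \<le> k}"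
      by blast
  qed
  show "finite (mset ` {xs. set xs \<subseteq> {..k} \<and> length xs \<le> k})"
    by (intro finite_imageI finite_lists_length_le) simp
qed

text \<open>The orbits of \<omega> cut the chosen tuple \<open>p\<close> into disjoint pieces, whose
  sizes add up to \<open>k\<close>; no piece is empty, since every orbit inside
  \<open>\<Union>c\<close> meets \<open>p\<close>.\<close>

lemma cycle_partition_partition_of:
  assumes perm: "permutation \<omega>" and c: "c = orbit (image \<omega>) p0"
    and card: "\<And>p. p \<in> c \<Longrightarrow> finite p \<and> card p = k" and fin: "finite (\<Union>c)"
  shows "partition_of (cycle_partition \<omega> c) k"
proof -
  define p where "p = (SOME p. p \<in> c)"
  have "p0 \<in> c"
    using self_in_orbit_image[OF perm] c by simp
  then have "p \<in> c"
    unfolding p_def by (rule someI)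
  let ?Z = "orbit \<omega> ` \<Union>c"
  note self = permutation_self_in_orbit[OF perm]
  have finp: "finite p" "card p = k"
    using card \<open>p \<in> c\<close> by auto
  have "finite ?Z"
    using fin by simp
  have meets: "p \<inter> z \<noteq> {}" if "z \<in> ?Z" for z
  proof -
    from that obtain x q where xq: "x \<in> q" "q \<in> c" "z = orbit \<omega> x"
      by auto
    \<comment> \<open>Both tuples lie in the orbit of \<open>p0\<close>, so a power of \<omega>
      carries \<open>q\<close> onto \<open>p\<close>; it moves \<open>x\<close> into
      \<open>p\<close> without leaving the orbit \<open>z\<close>.\<close>
    have "p \<in> orbit (image \<omega>) q"
      using orbit_eq[OF self_in_orbit_image[OF perm]] \<open>p \<in> c\<close> \<open>q \<in> c\<close> unfolding c by metis
    then obtain n where "p = (\<omega> ^^ n) ` q"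
      by (auto simp: orbit_altdef funpow_image)
    moreover have "(\<omega> ^^ n) x \<in> z"
      using funpow_in_orbit[OF self] xq by simp
    ultimately show ?thesis
      using xq by blast
  qed
  have "sum_mset (cycle_partition \<omega> c) = (\<Sum>z\<in>?Z. card (p \<inter> z))"
    by (simp add: cycle_partition_def p_def[symmetric] Let_def sum_unfold_sum_mset)
  also have "\<dots> = card (\<Union>z\<in>?Z. p \<inter> z)"
  proof (rule card_UN_disjoint'[symmetric])
    show "disjoint_family_on ((\<inter>) p) ?Z"
      using disjoint_orbits[of \<omega> "\<Union>c", OF self] by (rule disjoint_family_on_bisimulation) (simp add: disjoint_iff)
  qed (use \<open>finite ?Z\<close> finp in auto)
  also have "(\<Union>z\<in>?Z. p \<inter> z) = p"
    using self \<open>p \<in> c\<close> by auto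
  finally have "sum_mset (cycle_partition \<omega> c) = k"
    using finp by simp
  moreover have "0 \<notin># cycle_partition \<omega> c"
    using finp \<open>finite ?Z\<close>
    by (auto simp: cycle_partition_def p_def[symmetric] Let_def dest: meets[OF imageI, OF UnionI])
  ultimately show ?thesis
    by (simp add: partition_of_def is_partition_def)
qed

text \<open>Reduces degrees to counting the tuples of the support, a number independent of the
  permutation.\<close>

lemma family_size_pp_type:
  assumes k: "1 \<le> k" and a: "a \<in> partial_perms k"
  shows "family_size k (pp_type k a) = card (ktuples_in k (fst a))"
proof -
  obtain d \<omega> where a_eq: "a = (d, \<omega>)"
    by (cases a)
  let ?T = "ktuples_in k d" and ?C = "orbit (image \<omega>) ` ktuples_in k d"
  from a have d: "d \<in> ktuple_unions k" and \<omega>: "\<omega> permutes d"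
    and inv: "\<And>p. p \<in> ?T \<Longrightarrow> \<omega> ` p \<in> ?T"
    by (auto simp: a_eq partial_perms_def tuple_perms_def)
  have perm: "permutation \<omega>"
    using permutes_imp_permutation[OF finite_ktuple_union[OF d] \<omega>] .
  note finT = finite_ktuples_in[OF k d]
  have sub: "c \<subseteq> ?T" if "c \<in> ?C" for c
    using that orbit_in_invariant[of _ ?T "image \<omega>", OF _ inv] by blast
  have Un: "\<Union>?C = ?T"
    using sub self_in_orbit_image[OF perm] by auto
  have part: "partition_of (cycle_partition \<omega> c) k" if c: "c \<in> ?C" for c
  proof -
    have "\<Union>c \<subseteq> d"
      using sub[OF c] by (auto simp: ktuples_in_def)
    then have "finite (\<Union>c)"
      using finite_ktuple_union[OF d] finite_subset by blast
    moreover have "finite p \<and> card p = k" if "p \<in> c" for p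
      using sub[OF c] that card_ktuple by (auto simp: ktuples_in_def ktuple_def)
    moreover obtain p0 where "c = orbit (image \<omega>) p0"
      using c by blast
    ultimately show ?thesis
      using cycle_partition_partition_of[OF perm] by blast
  qed
  have "family_size k (pp_type k a) =
      (\<Sum>\<rho>\<in>{\<rho>. partition_of \<rho> k}. \<Sum>c\<in>{c \<in> ?C. cycle_partition \<omega> c = \<rho>}. card c)"
    by (simp add: a_eq family_size_def pp_type_def tuple_cycles_def sum_unfold_sum_mset)
  \<comment> \<open>The inner sums group the cycles by \<open>cycle_partition\<close>; by
    \<open>part\<close> no cycle falls outside the index set.\<close>
  also have "\<dots> = (\<Sum>c\<in>?C. card c)"
    using finT part by (intro sum.group finite_partitions) auto
  also have "\<dots> = card (\<Union>c\<in>?C. id c)"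
    using disjoint_orbits[OF self_in_orbit_image[OF perm], of ?T] finT finite_subset[OF sub finT]
    by (subst card_UN_disjoint') auto
  finally show ?thesis
    using Un by (simp add: a_eq)
qed

text \<open>The tuples of the product are the union of those of the factors, so both bounds are the
  usual ones for the cardinality of a union.\<close>

lemma family_size_pp_mult:
  assumes "1 \<le> k" "a \<in> partial_perms k" "b \<in> partial_perms k" "pp_mult a b \<in> partial_perms k"
  shows "max (family_size k (pp_type k a)) (family_size k (pp_type k b))
           \<le> family_size k (pp_type k (pp_mult a b))"
    and "family_size k (pp_type k (pp_mult a b))
           \<le> family_size k (pp_type k a) + family_size k (pp_type k b)"
proof -
  have d: "fst a \<in> ktuple_unions k" "fst b \<in> ktuple_unions k"
    using assms by (auto simp: partial_perms_def)
  have "ktuples_in k (fst (pp_mult a b)) = ktuples_in k (fst a) \<union> ktuples_in k (fst b)"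
    using ktuples_in_Un[OF assms(1) d] by (simp add: pp_mult_def)
  then show "max (family_size k (pp_type k a)) (family_size k (pp_type k b))
           \<le> family_size k (pp_type k (pp_mult a b))"
    and "family_size k (pp_type k (pp_mult a b))
           \<le> family_size k (pp_type k a) + family_size k (pp_type k b)"
    using assms d finite_ktuples_in[OF assms(1)]
    by (auto simp: family_size_pp_type card_Un_le intro!: card_mono)
qed


section \<open>Coefficients in the basis of class sums\<close>

lemma sum_fun_apply: "(\<Sum>i\<in>S. f i) a = (\<Sum>i\<in>S. f i a)"
  by (induction S rule: infinite_finite_induct) auto

lemma I_infty_apply:
  assumes "fs.independent (class_basis k)" "x \<in> I_infty k"
  defines "r \<equiv> fs.representation (class_basis k) x"
  shows "x a = (\<Sum>b | r b \<noteq> 0. r b * b a)"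
proof -
  have "x a = (\<Sum>b | r b \<noteq> 0. fs_scale (r b) b) a"
    using assms fs.sum_nonzero_representation_eq by (simp add: I_infty_def)
  then show ?thesis
    by (simp add: sum_fun_apply fs_scale_def)
qed

lemma representation_class_basisE:
  assumes "fs.representation (class_basis k) x b \<noteq> 0"
  obtains \<Lambda> where "\<Lambda> \<in> families k" "b = class_sum k \<Lambda>"
  using fs.representation_ne_zero[OF assms] by (auto simp: class_basis_def)

text \<open>A nonzero value at \<open>a\<close> must come from some class sum in the expansion.
  Hence the type of \<open>a\<close> is an admissible index in \<open>extend_degree\<close>.\<close>

lemma I_infty_support:
  assumes "fs.independent (class_basis k)" "x \<in> I_infty k" "x a \<noteq> 0"
  shows "a \<in> partial_perms k" "pp_type k a \<in> families k"
proof -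
  let ?r = "fs.representation (class_basis k) x"
  have "(\<Sum>b | ?r b \<noteq> 0. ?r b * b a) \<noteq> 0"
    using I_infty_apply[OF assms(1,2), of a] assms(3) by simp
  then obtain b where "?r b \<noteq> 0" "b a \<noteq> 0"
    by (rule sum.not_neutral_contains_not_neutral) auto
  obtain \<Lambda> where "\<Lambda> \<in> families k" "b = class_sum k \<Lambda>"
    using \<open>?r b \<noteq> 0\<close> by (rule representation_class_basisE)
  with \<open>b a \<noteq> 0\<close> show "a \<in> partial_perms k" "pp_type k a \<in> families k"
    by (auto simp: class_sum_def split: if_splits)
qed

text \<open>Class sums have disjoint supports and take the value 1 there, so a coefficient can be
  read off at any member of the class.\<close>

lemma class_coeff_pp_type:
  assumes "fs.independent (class_basis k)" "x \<in> I_infty k" "a \<in> partial_perms k"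
  shows "class_coeff k x (pp_type k a) = x a"
proof -
  let ?r = "fs.representation (class_basis k) x" and ?b = "class_sum k (pp_type k a)"
  have "x a = (\<Sum>b | ?r b \<noteq> 0. ?r b * b a)"
    by (rule I_infty_apply[OF assms(1,2)])
  also have "\<dots> = (\<Sum>b | ?r b \<noteq> 0. if b = ?b then ?r b else 0)"
  proof (intro sum.cong refl)
    fix b assume "b \<in> {b. ?r b \<noteq> 0}"
    then have "?r b \<noteq> 0"
      by simp
    then obtain \<Lambda> where "b = class_sum k \<Lambda>"
      by (rule representation_class_basisE)
    moreover have "class_sum k \<Lambda> a = (if pp_type k a = \<Lambda> then 1 else 0)" "?b a = 1"
      using assms(3) by (auto simp: class_sum_def)
    \<comment> \<open>If the types differ, then \<open>b a = 0\<close> while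
      \<open>?b a = 1\<close>, so \<open>b\<close> and \<open>?b\<close> are different
      functions.\<close>
    ultimately show "?r b * b a = (if b = ?b then ?r b else 0)"
      by (cases "pp_type k a = \<Lambda>") auto
  qed
  \<comment> \<open>If \<open>?b\<close> is missing from the index set, then
    \<open>?r ?b = 0\<close> and both sides vanish.\<close>
  also have "\<dots> = ?r ?b"
    using fs.finite_representation[of "class_basis k" x] by (simp add: sum.delta)
  finally show ?thesis
    by (simp add: class_coeff_def)
qed

lemma class_coeff_nonzeroD:
  assumes "class_coeff k x \<Gamma> \<noteq> 0" "\<Gamma> \<in> families k"
  shows "fs.independent (class_basis k)"
    and "\<exists>c\<in>partial_perms k. pp_type k c = \<Gamma> \<and> x c \<noteq> 0"
proof -
  from assms have ind: "fs.independent (class_basis k)" and x: "x \<in> I_infty k"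
    by (auto simp: class_coeff_def fs.representation_def I_infty_def split: if_splits)
  show "fs.independent (class_basis k)"
    by fact
  \<comment> \<open>An independent set does not contain 0, whereas the class sum of a type without
    members would be 0. So some \<open>c\<close> has type \<Gamma>.\<close>
  have "class_sum k \<Gamma> \<noteq> 0"
    using ind fs.dependent_zero assms(2) by (force simp: class_basis_def)
  then obtain c where "c \<in> partial_perms k" "pp_type k c = \<Gamma>"
    by (auto simp: class_sum_def fun_eq_iff split: if_splits)
  then show "\<exists>c\<in>partial_perms k. pp_type k c = \<Gamma> \<and> x c \<noteq> 0"
    using class_coeff_pp_type[OF ind x] assms(1) by metis
qed

lemma class_coeff_fs_mult_nonzeroD:
  assumes "class_coeff k (fs_mult k x y) \<Gamma> \<noteq> 0" "\<Gamma> \<in> families k"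
  shows "\<exists>a\<in>partial_perms k. \<exists>b\<in>partial_perms k. pp_mult a b \<in> partial_perms k \<and>
           pp_type k (pp_mult a b) = \<Gamma> \<and> x a \<noteq> 0 \<and> y b \<noteq> 0"
proof -
  obtain c where c: "c \<in> partial_perms k" "pp_type k c = \<Gamma>" "fs_mult k x y c \<noteq> 0"
    using class_coeff_nonzeroD(2)[OF assms] by blast
  from c(3) obtain a b where
    "a \<in> partial_perms k" "b \<in> partial_perms k" "pp_mult a b = c" "x a * y b \<noteq> 0"
    unfolding fs_mult_def by (rule sum.not_neutral_contains_not_neutral) auto
  with c show ?thesis
    by auto
qed

lemma is_filtration_family_size:
  assumes "1 \<le> k"
  shows "is_filtration k (extend_degree k (family_size k))"
  unfolding is_filtration_def
proof (intro ballI)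
  let ?D = "extend_degree k (family_size k)"
  fix x y assume x: "x \<in> I_infty k" and y: "y \<in> I_infty k"
  show "?D (fs_mult k x y) \<le> ?D x + ?D y"
    unfolding extend_degree_def[of _ _ "fs_mult k x y"]
  \<comment> \<open>It suffices to bound each index \<Gamma>; if there is none, the supremum is
    -\<infinity> and the claim is trivial.\<close>
  proof (rule SUP_least, clarify)
    fix \<Gamma> assume \<Gamma>: "\<Gamma> \<in> families k" "class_coeff k (fs_mult k x y) \<Gamma> \<noteq> 0"
    note ind = class_coeff_nonzeroD(1)[OF \<Gamma>(2,1)]
    obtain a b where ab: "a \<in> partial_perms k" "b \<in> partial_perms k"
      "pp_mult a b \<in> partial_perms k" "pp_type k (pp_mult a b) = \<Gamma>" "x a \<noteq> 0" "y b \<noteq> 0"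
      using class_coeff_fs_mult_nonzeroD[OF \<Gamma>(2,1)] by blast
    \<comment> \<open>The type of \<open>e\<close> occurs in the supremum defining
      \<open>?D z\<close>, because its coefficient is \<open>z e\<close>.\<close>
    have D: "ereal (real (family_size k (pp_type k e))) \<le> ?D z"
      if "z \<in> I_infty k" "e \<in> partial_perms k" "z e \<noteq> 0" for z e
      unfolding extend_degree_def
      using that class_coeff_pp_type[OF ind] I_infty_support[OF ind] by (intro SUP_upper) auto
    have "ereal (real (family_size k \<Gamma>)) \<le>
        ereal (real (family_size k (pp_type k a))) + ereal (real (family_size k (pp_type k b)))"
      using family_size_pp_mult(2)[OF assms ab(1-3)] ab(4) by simp
    also have "\<dots> \<le> ?D x + ?D y"
      using ab x y by (intro add_mono D)
    finally show "ereal (real (family_size k \<Gamma>)) \<le> ?D x + ?D y" .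
  qed
qed

theorem mainTheorem5:
  fixes k :: nat
  assumes "1 \<le> k"
  shows "(\<forall>\<Lambda>\<in>families k. \<forall>\<Delta>\<in>families k. \<forall>\<Gamma>\<in>families k.
            class_coeff k (fs_mult k (class_sum k \<Lambda>) (class_sum k \<Delta>)) \<Gamma> \<noteq> 0 \<longrightarrow>
              max (family_size k \<Lambda>) (family_size k \<Delta>) \<le> family_size k \<Gamma> \<and>
              family_size k \<Gamma> \<le> family_size k \<Lambda> + family_size k \<Delta>)
         \<and> is_filtration k (extend_degree k (family_size k))"
proof (intro conjI[OF _ is_filtration_family_size[OF assms]] ballI impI)
  fix \<Lambda> \<Delta> \<Gamma>
  assume "\<Gamma> \<in> families k"
    and "class_coeff k (fs_mult k (class_sum k \<Lambda>) (class_sum k \<Delta>)) \<Gamma> \<noteq> 0"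
  then obtain a b where ab: "a \<in> partial_perms k" "b \<in> partial_perms k"
    "pp_mult a b \<in> partial_perms k" "pp_type k (pp_mult a b) = \<Gamma>"
    "class_sum k \<Lambda> a \<noteq> 0" "class_sum k \<Delta> b \<noteq> 0"
    using class_coeff_fs_mult_nonzeroD by blast
  then have "pp_type k a = \<Lambda>" "pp_type k b = \<Delta>"
    by (auto simp: class_sum_def split: if_splits)
  with family_size_pp_mult[OF assms ab(1-3)] ab(4)
  show "max (family_size k \<Lambda>) (family_size k \<Delta>) \<le> family_size k \<Gamma> \<and>
        family_size k \<Gamma> \<le> family_size k \<Lambda> + family_size k \<Delta>"
    by simp
qed

end
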